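(* Let $0<\alpha<1$, $h>0$, and let the weights $w_j$ of the convolution quadrature $\partial_h^\alpha$ satisfy $w_0>0$ and $w_j<0$ for $j\ge1$. Then, for any sequence of functions $(y^n)_{n\ge0}\subseteq L^2$ with $y^0=0$, we have for every $n$ $$\frac12\,\partial_h^\alpha\|y^n\|^2\le\|y^n\|\left(\partial_h^\alpha\|y^n\|\right)\le(\partial_h^\alpha y^n,y^n).$$
   Context: $(\cdot,\cdot)$ and $\|\cdot\|$ denote the inner product and norm of $L^2=L^2(\Omega)$, $\Omega\subseteq\mathbb{R}^d$ a domain. The convolution quadrature with symbol $\delta$ is $\partial_h^\alpha v^n=\sum_{j=0}^n w_{n-j}v^j$ for a sequence $(v^j)$ with $v^0=0$ (of numbers or of functions), with weights defined by $\sum_{j\ge0}w_j\zeta^j=(\delta(\zeta)/h)^\alpha$, where $\delta$ is the symbol of the underlying ODE solver (e.g. $\delta(\zeta)=1-\zeta$ for implicit Euler, $\delta(\zeta)=1-\zeta+\frac12(1-\zeta)^2$ for BDF2). The symbol is consistent, $\delta(1)=0$, so that $\sum_{j=0}^\infty w_j=0$. The expressions $\partial_h^\alpha\|y^n\|$ and $\partial_h^\alpha\|y^n\|^2$ mean $\sum_{j=0}^n w_{n-j}\|y^j\|$ and $\sum_{j=0}^n w_{n-j}\|y^j\|^2$. *)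

theory Defs
  imports "HOL-Analysis.Analysis"
begin

definition is_domain :: "(real ^ 'd) set \<Rightarrow> bool" where
  "is_domain \<Omega> \<longleftrightarrow> open \<Omega> \<and> connected \<Omega> \<and> \<Omega> \<noteq> {}"

text \<open>Elements of $L^2(\Omega)$ are real-valued and handled through pointwise representatives;
  equality in $L^2(\Omega)$ is equality almost everywhere.\<close>

definition L2 :: "(real ^ 'd) set \<Rightarrow> (real ^ 'd \<Rightarrow> real) set" where
  "L2 \<Omega> = {f \<in> borel_measurable (lebesgue_on \<Omega>). integrable (lebesgue_on \<Omega>) (\<lambda>x. (f x)\<^sup>2)}"

definition L2_inner :: "(real ^ 'd) set \<Rightarrow> (real ^ 'd \<Rightarrow> real) \<Rightarrow> (real ^ 'd \<Rightarrow> real) \<Rightarrow> real" where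
  "L2_inner \<Omega> f g = (LINT x|lebesgue_on \<Omega>. f x * g x)"

definition L2_norm :: "(real ^ 'd) set \<Rightarrow> (real ^ 'd \<Rightarrow> real) \<Rightarrow> real" where
  "L2_norm \<Omega> f = sqrt (L2_inner \<Omega> f f)"

text \<open>Continuity is only required for approach to 1 from inside the unit disc: this is what makes
  \<open>\<delta> 1 = 0\<close> yield that the weights sum to 0.\<close>

definition consistent_symbol :: "(complex \<Rightarrow> complex) \<Rightarrow> bool" where
  "consistent_symbol \<delta> \<longleftrightarrow> continuous (at 1 within ball 0 1) \<delta> \<and> \<delta> 1 = 0"

text \<open>By uniqueness of power series coefficients, \<open>\<delta>\<close>, \<open>\<alpha>\<close> and \<open>h\<close> determine \<open>w\<close>.
  The power is the principal branch.\<close>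

definition cq_weights :: "(complex \<Rightarrow> complex) \<Rightarrow> real \<Rightarrow> real \<Rightarrow> (nat \<Rightarrow> real) \<Rightarrow> bool" where
  "cq_weights \<delta> \<alpha> h w \<longleftrightarrow>
     (\<forall>\<zeta>. norm \<zeta> < 1 \<longrightarrow>
        (\<lambda>j. complex_of_real (w j) * \<zeta> ^ j) sums
          ((\<delta> \<zeta> / complex_of_real h) powr complex_of_real \<alpha>))"

definition cq :: "(nat \<Rightarrow> real) \<Rightarrow> (nat \<Rightarrow> real) \<Rightarrow> nat \<Rightarrow> real" where
  "cq w v n = (\<Sum>j=0..n. w (n - j) * v j)"

definition cq_fun :: "(nat \<Rightarrow> real) \<Rightarrow> (nat \<Rightarrow> 'a \<Rightarrow> real) \<Rightarrow> nat \<Rightarrow> 'a \<Rightarrow> real" where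
  "cq_fun w y n = (\<lambda>x. \<Sum>j=0..n. w (n - j) * y j x)"

end

theory Submission
  imports Defs
begin

text \<open>The partial sums of the weights are nonnegative: as \<open>w\<^sub>j < 0\<close> for \<open>j \<ge> 1\<close>, each partial sum
  of the generating function at \<open>x \<in> (0, 1)\<close> dominates its value there, which tends to 0 as
  \<open>x \<rightarrow> 1\<close> by consistency. Writing \<open>a\<^sub>j\<close> for the norm of the \<open>j\<close>-th function, twice the difference
  of the two sides of the first inequality is the sum of
  \<open>w\<^sub>n\<^sub>-\<^sub>j (a\<^sub>n\<^sup>2 - (a\<^sub>n - a\<^sub>j)\<^sup>2)\<close> over \<open>j \<le> n\<close>, hence nonnegative.
  The second inequality is Cauchy-Schwarz in the terms \<open>j < n\<close>, whose weights are negative.\<close>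

text \<open>The product is dominated by the sum of the squares, since 2|ab| \<le> a^2 + b^2.\<close>

lemma integrable_mult_of_squares:
  fixes f g :: "'a \<Rightarrow> real"
  assumes [measurable]: "f \<in> borel_measurable M" "g \<in> borel_measurable M"
    and "integrable M (\<lambda>x. (f x)\<^sup>2)" "integrable M (\<lambda>x. (g x)\<^sup>2)"
  shows "integrable M (\<lambda>x. f x * g x)"
proof (rule Bochner_Integration.integrable_bound)
  show "integrable M (\<lambda>x. (f x)\<^sup>2 + (g x)\<^sup>2)"
    using assms by simp
  show "AE x in M. norm (f x * g x) \<le> norm ((f x)\<^sup>2 + (g x)\<^sup>2)"
  proof (rule AE_I2)
    fix x
    have "2 * \<bar>f x\<bar> * \<bar>g x\<bar> \<le> \<bar>f x\<bar>\<^sup>2 + \<bar>g x\<bar>\<^sup>2"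
      by (rule sum_squares_bound)
    moreover have "0 \<le> \<bar>f x\<bar> * \<bar>g x\<bar>"
      by simp
    ultimately have "\<bar>f x\<bar> * \<bar>g x\<bar> \<le> (f x)\<^sup>2 + (g x)\<^sup>2"
      unfolding power2_abs mult.assoc by linarith
    then show "norm (f x * g x) \<le> norm ((f x)\<^sup>2 + (g x)\<^sup>2)"
      by (simp add: abs_mult)
  qed
qed measurable

lemma integral_Cauchy_Schwarz:
  fixes f g :: "'a \<Rightarrow> real"
  assumes f [measurable]: "f \<in> borel_measurable M" and g [measurable]: "g \<in> borel_measurable M"
    and f2: "integrable M (\<lambda>x. (f x)\<^sup>2)" and g2: "integrable M (\<lambda>x. (g x)\<^sup>2)"
  shows "(LINT x|M. f x * g x) \<le> sqrt (LINT x|M. (f x)\<^sup>2) * sqrt (LINT x|M. (g x)\<^sup>2)"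
proof -
  define A where "A = (LINT x|M. (f x)\<^sup>2)"
  define B where "B = (LINT x|M. (g x)\<^sup>2)"
  define C where "C = (LINT x|M. f x * g x)"
  have fg: "integrable M (\<lambda>x. f x * g x)"
    using assms by (rule integrable_mult_of_squares)
  have "A \<ge> 0" "B \<ge> 0"
    by (simp_all add: A_def B_def)
  have "C\<^sup>2 \<le> A * B"
  \<comment> \<open>If \<open>B = 0\<close>, the expanded square below degenerates to 0 \<le> 0;
    here \<open>g\<close> vanishes almost everywhere, and with it \<open>C\<close>.\<close>
  proof (cases "B = 0")
    case True
    then have "AE x in M. (g x)\<^sup>2 = 0"
      using integral_nonneg_eq_0_iff_AE[OF g2] by (simp add: B_def)
    then have "AE x in M. f x * g x = 0"
      by eventually_elim simp
    then have "C = 0"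
      unfolding C_def by (rule integral_eq_zero_AE)
    then show ?thesis
      using True by simp
  next
    case False
    \<comment> \<open>The integrand is the square of \<open>B\<close> times the component of
      \<open>f\<close> orthogonal to \<open>g\<close>; the scaling by \<open>B\<close> avoids a
      division.\<close>
    have "0 \<le> (LINT x|M. (B * f x - C * g x)\<^sup>2)"
      by simp
    also have "\<dots> = (LINT x|M. B\<^sup>2 * (f x)\<^sup>2 - 2 * B * C * (f x * g x) + C\<^sup>2 * (g x)\<^sup>2)"
      by (rule Bochner_Integration.integral_cong) (simp_all add: power2_eq_square algebra_simps)
    also have "\<dots> = B\<^sup>2 * A - 2 * B * C * C + C\<^sup>2 * B"
      using f2 g2 fg by (simp add: A_def B_def C_def)
    also have "\<dots> = B * (A * B - C\<^sup>2)"
      by (simp add: power2_eq_square algebra_simps)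
    finally show ?thesis
      using False \<open>B \<ge> 0\<close> by (simp add: zero_le_mult_iff)
  qed
  then have "\<bar>C\<bar> \<le> sqrt (A * B)"
    by (simp add: real_le_rsqrt)
  then show ?thesis
    by (simp add: real_sqrt_mult A_def B_def C_def)
qed

lemma L2_inner_le:
  assumes "f \<in> L2 \<Omega>" "g \<in> L2 \<Omega>"
  shows "L2_inner \<Omega> f g \<le> L2_norm \<Omega> f * L2_norm \<Omega> g"
  using integral_Cauchy_Schwarz[of f "lebesgue_on \<Omega>" g] assms
  by (simp add: L2_def L2_inner_def L2_norm_def power2_eq_square)

lemma L2_norm_power2: "(L2_norm \<Omega> f)\<^sup>2 = L2_inner \<Omega> f f"
  by (simp add: L2_norm_def L2_inner_def)

text \<open>Linearity of the integral over the finite sum; it requires each product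
  \<open>y j x * g x\<close> to be integrable, which is where membership in \<open>L2\<close>
  enters.\<close>

lemma L2_inner_cq_fun:
  assumes "\<And>j. y j \<in> L2 \<Omega>" "g \<in> L2 \<Omega>"
  shows "L2_inner \<Omega> (cq_fun w y n) g = cq w (\<lambda>j. L2_inner \<Omega> (y j) g) n"
proof -
  have "integrable (lebesgue_on \<Omega>) (\<lambda>x. y j x * g x)" for j
    using assms unfolding L2_def by (blast intro: integrable_mult_of_squares)
  then show ?thesis
    by (simp add: L2_inner_def cq_fun_def cq_def sum_distrib_right mult.assoc)
qed

lemma cq_weights_partial_sum_nonneg:
  assumes "0 < \<alpha>" and "consistent_symbol \<delta>" and w: "cq_weights \<delta> \<alpha> h w"
    and neg: "\<And>j. j \<ge> 1 \<Longrightarrow> w j < 0"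
  shows "0 \<le> (\<Sum>j\<le>n. w j)"
proof -
  \<comment> \<open>The generating function is complex-valued, so its modulus is used: it bounds the
    real part from below by \<open>- F x\<close> and depends on \<delta> only through its
    norm.\<close>
  define F where
    "F x = norm ((\<delta> (complex_of_real x) / complex_of_real h) powr complex_of_real \<alpha>)" for x
  have ev: "eventually (\<lambda>x::real. 0 < x \<and> x < 1) (at_left 1)"
    using eventually_at_left_real[of 0 1] by simp
  have le: "- F x \<le> (\<Sum>j\<le>n. w j * x ^ j)" if x: "0 < x" "x < 1" for x
  proof -
    have sums: "(\<lambda>j. complex_of_real (w j * x ^ j)) sums
        ((\<delta> (complex_of_real x) / complex_of_real h) powr complex_of_real \<alpha>)" (is "_ sums ?S")
      using w x unfolding cq_weights_def by simp
    have re: "(\<lambda>j. w j * x ^ j) sums Re ?S"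
      using sums_Re[OF sums] by simp
    have "- F x \<le> Re ?S"
      using abs_Re_le_cmod[of ?S] by (simp add: F_def)
    \<comment> \<open>From index \<open>n\<close> on, every further term is nonpositive, so the
      partial sums decrease to their limit.\<close>
    also have "Re ?S \<le> (\<Sum>j\<le>n. w j * x ^ j)"
    proof (rule LIMSEQ_le_const2)
      show "(\<lambda>m. \<Sum>j\<le>m. w j * x ^ j) \<longlonglongrightarrow> Re ?S"
        using re by (simp add: sums_def_le)
      have "(\<Sum>j\<le>m. w j * x ^ j) \<le> (\<Sum>j\<le>n. w j * x ^ j)" if "n \<le> m" for m
        using that
      proof (induction m rule: dec_induct)
        case (step m)
        have "w (Suc m) * x ^ Suc m \<le> 0"
          using neg[of "Suc m"] x by (intro mult_nonpos_nonneg) auto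
        then show ?case
          using step by simp
      qed simp
      then show "\<exists>N. \<forall>m\<ge>N. (\<Sum>j\<le>m. w j * x ^ j) \<le> (\<Sum>j\<le>n. w j * x ^ j)"
        by blast
    qed
    finally show ?thesis .
  qed
  \<comment> \<open>Consistency gives a limit inside the open disc; the real points just below 1 lie
    there and differ from 1.\<close>
  have lim_arg: "filterlim complex_of_real (at 1 within ball 0 1) (at_left 1)"
    unfolding filterlim_at
  proof
    show "(complex_of_real \<longlongrightarrow> 1) (at_left 1)"
      using tendsto_of_real[OF tendsto_ident_at, of "1::real" "{..<1}"] by simp
    show "\<forall>\<^sub>F x in at_left 1. complex_of_real x \<in> ball 0 1 \<and> complex_of_real x \<noteq> 1"
      using ev by eventually_elim auto
  qed
  have "(\<delta> \<longlongrightarrow> 0) (at 1 within ball 0 1)"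
    using \<open>consistent_symbol \<delta>\<close> by (auto simp: consistent_symbol_def continuous_within)
  then have "((\<lambda>x. \<delta> (complex_of_real x)) \<longlongrightarrow> 0) (at_left 1)"
    using lim_arg by (rule filterlim_compose)
  then have "((\<lambda>x. norm (\<delta> (complex_of_real x) / complex_of_real h)) \<longlongrightarrow> 0) (at_left 1)"
    by (intro tendsto_norm_zero tendsto_divide_zero)
  \<comment> \<open>For a real exponent the modulus of the power is the power of the modulus,
    whatever the argument of the base; it tends to 0 because \<alpha> is positive.\<close>
  then have "(F \<longlongrightarrow> 0) (at_left 1)"
    unfolding F_def using \<open>0 < \<alpha>\<close>
    by (simp only: norm_powr_real_powr'[OF Reals_of_real] Re_complex_of_real)
      (rule tendsto_zero_powrI, auto)
  then have "((\<lambda>x. - F x) \<longlongrightarrow> 0) (at_left 1)"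
    using tendsto_minus by fastforce
  moreover have "((\<lambda>x. \<Sum>j\<le>n. w j * x ^ j) \<longlongrightarrow> (\<Sum>j\<le>n. w j * 1 ^ j)) (at_left 1)"
    by (intro tendsto_intros)
  moreover have "eventually (\<lambda>x. - F x \<le> (\<Sum>j\<le>n. w j * x ^ j)) (at_left 1)"
    using ev by eventually_elim (use le in auto)
  ultimately show ?thesis
    using tendsto_le[OF trivial_limit_at_left_real] by fastforce
qed

lemma cq_power2_le:
  assumes "0 \<le> (\<Sum>j\<le>n. w j)" and neg: "\<And>j. j \<ge> 1 \<Longrightarrow> w j < 0"
  shows "1/2 * cq w (\<lambda>j. (a j)\<^sup>2) n \<le> a n * cq w a n"
proof -
  have "(\<Sum>j=0..n. w (n - j) * (a n - a j)\<^sup>2) \<le> 0"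
  proof (rule sum_nonpos)
    fix j assume "j \<in> {0..n}"
    \<comment> \<open>The term \<open>j = n\<close> carries \<open>w 0\<close>, but its squared
      difference is 0.\<close>
    then have "j = n \<or> w (n - j) \<le> 0"
      using neg[of "n - j"] by force
    then show "w (n - j) * (a n - a j)\<^sup>2 \<le> 0"
      by (auto intro: mult_nonpos_nonneg)
  qed
  moreover have "(\<Sum>j=0..n. w (n - j)) = (\<Sum>j\<le>n. w j)"
    using sum.nat_diff_reindex[of w "Suc n"] by (simp add: atLeast0AtMost lessThan_Suc_atMost)
  then have "0 \<le> (a n)\<^sup>2 * (\<Sum>j=0..n. w (n - j))"
    using assms(1) by simp
  \<comment> \<open>Completing the square termwise: \<open>2 * a n * a j - (a j)\<^sup>2 = (a
    n)\<^sup>2 - (a n - a j)\<^sup>2\<close>.\<close>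
  moreover have "2 * (a n * cq w a n) - cq w (\<lambda>j. (a j)\<^sup>2) n =
      (a n)\<^sup>2 * (\<Sum>j=0..n. w (n - j)) - (\<Sum>j=0..n. w (n - j) * (a n - a j)\<^sup>2)"
    unfolding cq_def sum_distrib_left sum_subtractf[symmetric]
    by (rule sum.cong) (simp_all add: power2_eq_square algebra_simps)
  ultimately show ?thesis
    by simp
qed

theorem proposition2:
  fixes \<Omega> :: "(real ^ 'd) set"
    and \<delta> :: "complex \<Rightarrow> complex"
    and \<alpha> h :: real
    and w :: "nat \<Rightarrow> real"
    and y :: "nat \<Rightarrow> real ^ 'd \<Rightarrow> real"
    and n :: nat
  assumes "is_domain \<Omega>"
    and "0 < \<alpha>" and "\<alpha> < 1" and "h > 0"
    and "consistent_symbol \<delta>"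
    and "cq_weights \<delta> \<alpha> h w"
    and "w 0 > 0" and "\<And>j. j \<ge> 1 \<Longrightarrow> w j < 0"
    and "\<And>k. y k \<in> L2 \<Omega>"
    and "AE x in lebesgue_on \<Omega>. y 0 x = 0"
  shows "1/2 * cq w (\<lambda>j. (L2_norm \<Omega> (y j))\<^sup>2) n
           \<le> L2_norm \<Omega> (y n) * cq w (\<lambda>j. L2_norm \<Omega> (y j)) n
       \<and> L2_norm \<Omega> (y n) * cq w (\<lambda>j. L2_norm \<Omega> (y j)) n
           \<le> L2_inner \<Omega> (cq_fun w y n) (y n)"
proof
  show "1/2 * cq w (\<lambda>j. (L2_norm \<Omega> (y j))\<^sup>2) n
      \<le> L2_norm \<Omega> (y n) * cq w (\<lambda>j. L2_norm \<Omega> (y j)) n"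
    by (intro cq_power2_le cq_weights_partial_sum_nonneg[OF assms(2,5,6)] assms(8))
  have "L2_norm \<Omega> (y n) * cq w (\<lambda>j. L2_norm \<Omega> (y j)) n
      = (\<Sum>j=0..n. w (n - j) * (L2_norm \<Omega> (y j) * L2_norm \<Omega> (y n)))"
    by (simp add: cq_def sum_distrib_left mult_ac)
  also have "\<dots> \<le> (\<Sum>j=0..n. w (n - j) * L2_inner \<Omega> (y j) (y n))"
  proof (rule sum_mono)
    fix j assume "j \<in> {0..n}"
    then consider "j = n" | "w (n - j) < 0"
      using assms(8)[of "n - j"] by force
    then show "w (n - j) * (L2_norm \<Omega> (y j) * L2_norm \<Omega> (y n))
        \<le> w (n - j) * L2_inner \<Omega> (y j) (y n)"
    \<comment> \<open>For \<open>j = n\<close> both sides agree, as the inner product of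
      \<open>y n\<close> with itself is its squared norm; for \<open>j < n\<close> the negative
      weight reverses Cauchy-Schwarz.\<close>
    proof cases
      case 1
      then show ?thesis
        by (simp add: L2_norm_power2 flip: power2_eq_square)
    next
      case 2
      then show ?thesis
        using L2_inner_le assms(9) by (intro mult_left_mono_neg) auto
    qed
  qed
  also have "\<dots> = L2_inner \<Omega> (cq_fun w y n) (y n)"
    using assms(9) by (simp add: L2_inner_cq_fun cq_def)
  finally show "L2_norm \<Omega> (y n) * cq w (\<lambda>j. L2_norm \<Omega> (y j)) n
      \<le> L2_inner \<Omega> (cq_fun w y n) (y n)" .
qed

end
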